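(* Shadows satisfy Morita invariance: let $\mathcal B$ be a bicategory equipped with a shadow $\langle\langle-\rangle\rangle$ taking values in a category $\mathcal D$, and let $(C,D,F,G,u,c)$ be an adjunction in $\mathcal B$. If the adjunction is an equivalence, i.e. if the 2-cells $u$ and $c$ are invertible, then the Euler characteristic $\chi(F)\colon\langle\langle U_C\rangle\rangle\to\langle\langle U_D\rangle\rangle$ is an isomorphism in $\mathcal D$ with inverse given by $\chi(G)$.
   Context: A bicategory $\mathcal B$ has hom-categories $\mathcal B(X,Y)$, unit 1-cells $U_X$, associator $a$, unitors $l,r$. A shadow on $\mathcal B$ with values in $\mathcal D$ is a functor $\langle\langle-\rangle\rangle\colon\coprod_{X}\mathcal B(X,X)\to\mathcal D$ with isomorphisms $\theta\colon\langle\langle FG\rangle\rangle\cong\langle\langle GF\rangle\rangle$, natural in $F\colon X\to Y$, $G\colon Y\to X$, such that: (i) for $F\colon X\to Y$, $G\colon Y\to Z$, $H\colon Z\to X$ the composites $\langle\langle H(GF)\rangle\rangle\xrightarrow{\theta}\langle\langle (GF)H\rangle\rangle\xrightarrow{\langle\langle a\rangle\rangle}\langle\langle G(FH)\rangle\rangle$ and $\langle\langle H(GF)\rangle\rangle\xrightarrow{\langle\langle a\rangle\rangle}\langle\langle (HG)F\rangle\rangle\xrightarrow{\theta}\langle\langle F(HG)\rangle\rangle\xrightarrow{\langle\langle a\rangle\rangle}\langle\langle (FH)G\rangle\rangle\xrightarrow{\theta}\langle\langle G(FH)\rangle\rangle$ agree; (ii) for $K\colon X\to X$, $\langle\langle l\rangle\rangle\circ\theta=\langle\langle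 r\rangle\rangle$ on $\langle\langle KU_X\rangle\rangle$ and $\langle\langle r\rangle\rangle\circ\theta=\langle\langle l\rangle\rangle$ on $\langle\langle U_XK\rangle\rangle$. An adjunction $(C,D,F,G,u,c)$ in $\mathcal B$ consists of objects $C,D$, 1-cells $F\colon C\to D$, $G\colon D\to C$, and 2-cells $u\colon U_C\Rightarrow GF$, $c\colon FG\Rightarrow U_D$ satisfying the triangle identities. Its Euler characteristic is $\chi(F)\colon\langle\langle U_C\rangle\rangle\xrightarrow{\langle\langle u\rangle\rangle}\langle\langle GF\rangle\rangle\xrightarrow{\theta}\langle\langle FG\rangle\rangle\xrightarrow{\langle\langle c\rangle\rangle}\langle\langle U_D\rangle\rangle$. When $u,c$ are invertible, $\chi(G)$ is the Euler characteristic of the adjunction $(D,C,G,F,c^{-1},u^{-1})$. *)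

theory Defs
  imports Main
begin

section \<open>Categories, functors, natural isomorphisms\<close>

record ('o, 'a) cat =
  Obj :: "'o set"
  Arr :: "'a set"
  Dom :: "'a \<Rightarrow> 'o"
  Cod :: "'a \<Rightarrow> 'o"
  Ident :: "'o \<Rightarrow> 'a"
  Comp :: "'a \<Rightarrow> 'a \<Rightarrow> 'a"  (infixl "\<cdot>\<index>" 70)

text \<open>Composition is in applicative order: \<open>g \<cdot> f\<close> is \<open>g\<close> after \<open>f\<close>. The operations are total
  HOL functions; their values are only constrained on the carriers and on composable pairs.\<close>

definition hom :: "('o, 'a) cat \<Rightarrow> 'o \<Rightarrow> 'o \<Rightarrow> 'a set" where
  "hom C x y = {f \<in> Arr C. Dom C f = x \<and> Cod C f = y}"

locale category =
  fixes C :: "('o, 'a) cat" (structure)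
  assumes Dom_in: "f \<in> Arr C \<Longrightarrow> Dom C f \<in> Obj C"
    and Cod_in: "f \<in> Arr C \<Longrightarrow> Cod C f \<in> Obj C"
    and Ident_hom: "x \<in> Obj C \<Longrightarrow> Ident C x \<in> hom C x x"
    and Comp_hom: "f \<in> hom C x y \<Longrightarrow> g \<in> hom C y z \<Longrightarrow> g \<cdot> f \<in> hom C x z"
    and Ident_left: "f \<in> hom C x y \<Longrightarrow> Ident C y \<cdot> f = f"
    and Ident_right: "f \<in> hom C x y \<Longrightarrow> f \<cdot> Ident C x = f"
    and Comp_assoc: "f \<in> hom C w x \<Longrightarrow> g \<in> hom C x y \<Longrightarrow> h \<in> hom C y z \<Longrightarrow>
                       (h \<cdot> g) \<cdot> f = h \<cdot> (g \<cdot> f)"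

definition inverse_arrows :: "('o, 'a) cat \<Rightarrow> 'a \<Rightarrow> 'a \<Rightarrow> bool" where
  "inverse_arrows C f g \<longleftrightarrow>
     (\<exists>x y. f \<in> hom C x y \<and> g \<in> hom C y x \<and>
            g \<cdot>\<^bsub>C\<^esub> f = Ident C x \<and> f \<cdot>\<^bsub>C\<^esub> g = Ident C y)"

definition is_iso :: "('o, 'a) cat \<Rightarrow> 'a \<Rightarrow> bool" where
  "is_iso C f \<longleftrightarrow> (\<exists>g. inverse_arrows C f g)"

definition inv_arr :: "('o, 'a) cat \<Rightarrow> 'a \<Rightarrow> 'a" where
  "inv_arr C f = (THE g. inverse_arrows C f g)"

definition prod_cat :: "('o1, 'a1) cat \<Rightarrow> ('o2, 'a2) cat \<Rightarrow> ('o1 \<times> 'o2, 'a1 \<times> 'a2) cat"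
    (infixr "\<times>\<^sub>C" 75) where
  "C \<times>\<^sub>C D =
     \<lparr> Obj = Obj C \<times> Obj D,
       Arr = Arr C \<times> Arr D,
       Dom = (\<lambda>(f, g). (Dom C f, Dom D g)),
       Cod = (\<lambda>(f, g). (Cod C f, Cod D g)),
       Ident = (\<lambda>(x, y). (Ident C x, Ident D y)),
       Comp = (\<lambda>(f', g') (f, g). (f' \<cdot>\<^bsub>C\<^esub> f, g' \<cdot>\<^bsub>D\<^esub> g)) \<rparr>"

definition coprod_cat :: "'i set \<Rightarrow> ('i \<Rightarrow> ('o, 'a) cat) \<Rightarrow> ('i \<times> 'o, 'i \<times> 'a) cat" where
  "coprod_cat I C =
     \<lparr> Obj = (SIGMA i:I. Obj (C i)),
       Arr = (SIGMA i:I. Arr (C i)),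
       Dom = (\<lambda>(i, f). (i, Dom (C i) f)),
       Cod = (\<lambda>(i, f). (i, Cod (C i) f)),
       Ident = (\<lambda>(i, x). (i, Ident (C i) x)),
       Comp = (\<lambda>(i, g) (j, f). (i, g \<cdot>\<^bsub>C i\<^esub> f)) \<rparr>"

definition is_functor ::
    "('o1, 'a1) cat \<Rightarrow> ('o2, 'a2) cat \<Rightarrow> ('o1 \<Rightarrow> 'o2) \<Rightarrow> ('a1 \<Rightarrow> 'a2) \<Rightarrow> bool" where
  "is_functor C D Fo Fa \<longleftrightarrow>
     category C \<and> category D \<and>
     (\<forall>x \<in> Obj C. Fo x \<in> Obj D) \<and>
     (\<forall>f \<in> Arr C. Fa f \<in> hom D (Fo (Dom C f)) (Fo (Cod C f))) \<and>
     (\<forall>x \<in> Obj C. Fa (Ident C x) = Ident D (Fo x)) \<and>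
     (\<forall>f \<in> Arr C. \<forall>g \<in> Arr C. Cod C f = Dom C g \<longrightarrow> Fa (g \<cdot>\<^bsub>C\<^esub> f) = Fa g \<cdot>\<^bsub>D\<^esub> Fa f)"

definition natural_iso ::
    "('o1, 'a1) cat \<Rightarrow> ('o2, 'a2) cat \<Rightarrow> ('o1 \<Rightarrow> 'o2) \<Rightarrow> ('a1 \<Rightarrow> 'a2) \<Rightarrow>
     ('o1 \<Rightarrow> 'o2) \<Rightarrow> ('a1 \<Rightarrow> 'a2) \<Rightarrow> ('o1 \<Rightarrow> 'a2) \<Rightarrow> bool" where
  "natural_iso C D Fo Fa Go Ga \<tau> \<longleftrightarrow>
     is_functor C D Fo Fa \<and> is_functor C D Go Ga \<and>
     (\<forall>x \<in> Obj C. \<tau> x \<in> hom D (Fo x) (Go x) \<and> is_iso D (\<tau> x)) \<and>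
     (\<forall>f \<in> Arr C. Ga f \<cdot>\<^bsub>D\<^esub> \<tau> (Dom C f) = \<tau> (Cod C f) \<cdot>\<^bsub>D\<^esub> Fa f)"

lemma inverse_arrows_sym: "inverse_arrows C f g \<Longrightarrow> inverse_arrows C g f"
  unfolding inverse_arrows_def by blast

context category
begin

lemma inverse_arrows_unique:
  assumes fg: "inverse_arrows C f g" and fh: "inverse_arrows C f h"
  shows "g = h"
proof -
  obtain x y where f: "f \<in> hom C x y" and g: "g \<in> hom C y x" and gf: "g \<cdot> f = Ident C x"
    using fg unfolding inverse_arrows_def by blast
  obtain h: "h \<in> hom C y x" and fh: "f \<cdot> h = Ident C y"
    using fh f unfolding inverse_arrows_def hom_def by auto
  have "g = g \<cdot> (f \<cdot> h)"
    using Ident_right[OF g] fh by simp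
  also have "\<dots> = h"
    using Comp_assoc[OF h f g] gf Ident_left[OF h] by simp
  finally show ?thesis .
qed

lemma inv_arr_eqI: "inverse_arrows C f g \<Longrightarrow> inv_arr C f = g"
  unfolding inv_arr_def using inverse_arrows_unique by blast

lemma inverse_arrows_inv_arr: "is_iso C f \<Longrightarrow> inverse_arrows C f (inv_arr C f)"
  unfolding is_iso_def using inv_arr_eqI by auto

lemma inverse_arrows_homD:
  "inverse_arrows C f g \<Longrightarrow> f \<in> hom C x y \<Longrightarrow>
     g \<in> hom C y x \<and> g \<cdot> f = Ident C x \<and> f \<cdot> g = Ident C y"
  unfolding inverse_arrows_def hom_def by auto

lemma inverse_arrows_Comp:
  assumes ff': "inverse_arrows C f f'" and gg': "inverse_arrows C g g'"
    and f: "f \<in> hom C x y" and g: "g \<in> hom C y z"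
  shows "inverse_arrows C (g \<cdot> f) (f' \<cdot> g')"
proof -
  have f': "f' \<in> hom C y x" "f' \<cdot> f = Ident C x" "f \<cdot> f' = Ident C y"
    using inverse_arrows_homD[OF ff' f] by auto
  have g': "g' \<in> hom C z y" "g' \<cdot> g = Ident C y" "g \<cdot> g' = Ident C z"
    using inverse_arrows_homD[OF gg' g] by auto
  have gf: "g \<cdot> f \<in> hom C x z" and fg: "f' \<cdot> g' \<in> hom C z x"
    using Comp_hom f g f'(1) g'(1) by blast+
  have "(f' \<cdot> g') \<cdot> (g \<cdot> f) = f' \<cdot> ((g' \<cdot> g) \<cdot> f)"
    using Comp_assoc[OF gf g'(1) f'(1)] Comp_assoc[OF f g g'(1)] by simp
  moreover have "(g \<cdot> f) \<cdot> (f' \<cdot> g') = g \<cdot> ((f \<cdot> f') \<cdot> g')"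
    using Comp_assoc[OF fg f g] Comp_assoc[OF g'(1) f'(1) f] by simp
  ultimately show ?thesis
    unfolding inverse_arrows_def
    using gf fg f' g' Ident_left[OF f] Ident_left[OF g'(1)] by metis
qed

end

lemma is_functor_inverse_arrows:
  assumes F: "is_functor C D Fo Fa" and fg: "inverse_arrows C f g"
  shows "inverse_arrows D (Fa f) (Fa g)"
proof -
  interpret C: category C using F by (simp add: is_functor_def)
  obtain x y where f: "f \<in> Arr C" "Dom C f = x" "Cod C f = y"
    and g: "g \<in> Arr C" "Dom C g = y" "Cod C g = x"
    and eqs: "g \<cdot>\<^bsub>C\<^esub> f = Ident C x" "f \<cdot>\<^bsub>C\<^esub> g = Ident C y"
    using fg unfolding inverse_arrows_def hom_def by auto
  have "x \<in> Obj C" "y \<in> Obj C" using C.Dom_in C.Cod_in f by auto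
  then show ?thesis
    unfolding inverse_arrows_def using F f g eqs unfolding is_functor_def by metis
qed


section \<open>Bicategories\<close>

text \<open>
  Since the hom-categories are not required to be disjoint, every operation carries the 0-cells it
  depends on as explicit leading arguments. Horizontal composition is in applicative order as well:
  for \<open>F : X \<rightarrow> Y\<close> and \<open>G : Y \<rightarrow> Z\<close> the composite \<open>hcomp1 X Y Z G F\<close> is \<open>GF : X \<rightarrow> Z\<close>, and
  \<open>hcomp2\<close> is the action of the composition functor on 2-cells. The constraints have the directions
  \<open>assoc W X Y Z H G F : (HG)F \<Rightarrow> H(GF)\<close>, \<open>lunit X Y F : U\<^sub>Y F \<Rightarrow> F\<close>, \<open>runit X Y F : F U\<^sub>X \<Rightarrow> F\<close>.
\<close>

record ('o, 'f, 't) bicat =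
  Cells0 :: "'o set"
  HomCat :: "'o \<Rightarrow> 'o \<Rightarrow> ('f, 't) cat"
  unit1 :: "'o \<Rightarrow> 'f"
  hcomp1 :: "'o \<Rightarrow> 'o \<Rightarrow> 'o \<Rightarrow> 'f \<Rightarrow> 'f \<Rightarrow> 'f"
  hcomp2 :: "'o \<Rightarrow> 'o \<Rightarrow> 'o \<Rightarrow> 't \<Rightarrow> 't \<Rightarrow> 't"
  assoc :: "'o \<Rightarrow> 'o \<Rightarrow> 'o \<Rightarrow> 'o \<Rightarrow> 'f \<Rightarrow> 'f \<Rightarrow> 'f \<Rightarrow> 't"
  lunit :: "'o \<Rightarrow> 'o \<Rightarrow> 'f \<Rightarrow> 't"
  runit :: "'o \<Rightarrow> 'o \<Rightarrow> 'f \<Rightarrow> 't"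

definition whisker_left ::
    "('o, 'f, 't) bicat \<Rightarrow> 'o \<Rightarrow> 'o \<Rightarrow> 'o \<Rightarrow> 'f \<Rightarrow> 't \<Rightarrow> 't" where
  "whisker_left B X Y Z G \<alpha> = hcomp2 B X Y Z (Ident (HomCat B Y Z) G) \<alpha>"

definition whisker_right ::
    "('o, 'f, 't) bicat \<Rightarrow> 'o \<Rightarrow> 'o \<Rightarrow> 'o \<Rightarrow> 't \<Rightarrow> 'f \<Rightarrow> 't" where
  "whisker_right B X Y Z \<beta> F = hcomp2 B X Y Z \<beta> (Ident (HomCat B X Y) F)"

definition assoc_inv ::
    "('o, 'f, 't) bicat \<Rightarrow> 'o \<Rightarrow> 'o \<Rightarrow> 'o \<Rightarrow> 'o \<Rightarrow> 'f \<Rightarrow> 'f \<Rightarrow> 'f \<Rightarrow> 't" where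
  "assoc_inv B W X Y Z H G F = inv_arr (HomCat B W Z) (assoc B W X Y Z H G F)"

locale bicategory =
  fixes B :: "('o, 'f, 't) bicat"
  assumes HomCat_category:
      "X \<in> Cells0 B \<Longrightarrow> Y \<in> Cells0 B \<Longrightarrow> category (HomCat B X Y)"
    and unit1_in: "X \<in> Cells0 B \<Longrightarrow> unit1 B X \<in> Obj (HomCat B X X)"
    and hcomp_functor:
      "X \<in> Cells0 B \<Longrightarrow> Y \<in> Cells0 B \<Longrightarrow> Z \<in> Cells0 B \<Longrightarrow>
       is_functor (HomCat B Y Z \<times>\<^sub>C HomCat B X Y) (HomCat B X Z)
         (\<lambda>(G, F). hcomp1 B X Y Z G F) (\<lambda>(\<beta>, \<alpha>). hcomp2 B X Y Z \<beta> \<alpha>)"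
    and assoc_natural_iso:
      "W \<in> Cells0 B \<Longrightarrow> X \<in> Cells0 B \<Longrightarrow> Y \<in> Cells0 B \<Longrightarrow> Z \<in> Cells0 B \<Longrightarrow>
       natural_iso (HomCat B Y Z \<times>\<^sub>C HomCat B X Y \<times>\<^sub>C HomCat B W X) (HomCat B W Z)
         (\<lambda>(H, G, F). hcomp1 B W X Z (hcomp1 B X Y Z H G) F)
         (\<lambda>(\<gamma>, \<beta>, \<alpha>). hcomp2 B W X Z (hcomp2 B X Y Z \<gamma> \<beta>) \<alpha>)
         (\<lambda>(H, G, F). hcomp1 B W Y Z H (hcomp1 B W X Y G F))
         (\<lambda>(\<gamma>, \<beta>, \<alpha>). hcomp2 B W Y Z \<gamma> (hcomp2 B W X Y \<beta> \<alpha>))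
         (\<lambda>(H, G, F). assoc B W X Y Z H G F)"
    and lunit_natural_iso:
      "X \<in> Cells0 B \<Longrightarrow> Y \<in> Cells0 B \<Longrightarrow>
       natural_iso (HomCat B X Y) (HomCat B X Y)
         (\<lambda>F. hcomp1 B X Y Y (unit1 B Y) F) (\<lambda>\<alpha>. whisker_left B X Y Y (unit1 B Y) \<alpha>)
         (\<lambda>F. F) (\<lambda>\<alpha>. \<alpha>) (lunit B X Y)"
    and runit_natural_iso:
      "X \<in> Cells0 B \<Longrightarrow> Y \<in> Cells0 B \<Longrightarrow>
       natural_iso (HomCat B X Y) (HomCat B X Y)
         (\<lambda>F. hcomp1 B X X Y F (unit1 B X)) (\<lambda>\<alpha>. whisker_right B X X Y \<alpha> (unit1 B X))
         (\<lambda>F. F) (\<lambda>\<alpha>. \<alpha>) (runit B X Y)"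
    and pentagon:
      "V \<in> Cells0 B \<Longrightarrow> W \<in> Cells0 B \<Longrightarrow> X \<in> Cells0 B \<Longrightarrow> Y \<in> Cells0 B \<Longrightarrow> Z \<in> Cells0 B \<Longrightarrow>
       F \<in> Obj (HomCat B V W) \<Longrightarrow> G \<in> Obj (HomCat B W X) \<Longrightarrow>
       H \<in> Obj (HomCat B X Y) \<Longrightarrow> K \<in> Obj (HomCat B Y Z) \<Longrightarrow>
       assoc B V X Y Z K H (hcomp1 B V W X G F)
         \<cdot>\<^bsub>HomCat B V Z\<^esub> assoc B V W X Z (hcomp1 B X Y Z K H) G F =
       whisker_left B V Y Z K (assoc B V W X Y H G F)
         \<cdot>\<^bsub>HomCat B V Z\<^esub> assoc B V W Y Z K (hcomp1 B W X Y H G) F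
         \<cdot>\<^bsub>HomCat B V Z\<^esub> whisker_right B V W Z (assoc B W X Y Z K H G) F"
    and triangle:
      "X \<in> Cells0 B \<Longrightarrow> Y \<in> Cells0 B \<Longrightarrow> Z \<in> Cells0 B \<Longrightarrow>
       F \<in> Obj (HomCat B X Y) \<Longrightarrow> G \<in> Obj (HomCat B Y Z) \<Longrightarrow>
       whisker_left B X Y Z G (lunit B X Y F) \<cdot>\<^bsub>HomCat B X Z\<^esub> assoc B X Y Y Z G (unit1 B Y) F =
       whisker_right B X Y Z (runit B Y Z G) F"

context bicategory
begin

lemma inverse_arrows_Ident:
  assumes "X \<in> Cells0 B" "Y \<in> Cells0 B" "F \<in> Obj (HomCat B X Y)"
  shows "inverse_arrows (HomCat B X Y) (Ident (HomCat B X Y) F) (Ident (HomCat B X Y) F)"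
proof -
  interpret category "HomCat B X Y" using HomCat_category assms by blast
  show ?thesis
    unfolding inverse_arrows_def using Ident_hom[OF assms(3)] Ident_left by blast
qed

lemma hcomp2_hom:
  assumes "X \<in> Cells0 B" "Y \<in> Cells0 B" "Z \<in> Cells0 B"
    and "\<alpha> \<in> hom (HomCat B X Y) F F'" "\<beta> \<in> hom (HomCat B Y Z) G G'"
  shows "hcomp2 B X Y Z \<beta> \<alpha> \<in> hom (HomCat B X Z) (hcomp1 B X Y Z G F) (hcomp1 B X Y Z G' F')"
  using hcomp_functor[OF assms(1-3)] assms(4,5)
  unfolding is_functor_def by (auto simp: prod_cat_def hom_def)

lemma hcomp2_inverse_arrows:
  assumes "X \<in> Cells0 B" "Y \<in> Cells0 B" "Z \<in> Cells0 B"
    and "inverse_arrows (HomCat B X Y) \<alpha> \<alpha>'" "inverse_arrows (HomCat B Y Z) \<beta> \<beta>'"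
  shows "inverse_arrows (HomCat B X Z) (hcomp2 B X Y Z \<beta> \<alpha>) (hcomp2 B X Y Z \<beta>' \<alpha>')"
proof -
  have "inverse_arrows (HomCat B Y Z \<times>\<^sub>C HomCat B X Y) (\<beta>, \<alpha>) (\<beta>', \<alpha>')"
    using assms(4,5) by (fastforce simp: inverse_arrows_def prod_cat_def hom_def)
  then show ?thesis
    using is_functor_inverse_arrows[OF hcomp_functor[OF assms(1-3)]] by fastforce
qed

lemma hcomp1_in:
  assumes "X \<in> Cells0 B" "Y \<in> Cells0 B" "Z \<in> Cells0 B"
    and "F \<in> Obj (HomCat B X Y)" "G \<in> Obj (HomCat B Y Z)"
  shows "hcomp1 B X Y Z G F \<in> Obj (HomCat B X Z)"
  using hcomp_functor[OF assms(1-3)] assms(4,5)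
  unfolding is_functor_def by (auto simp: prod_cat_def)

lemma whisker_left_hom:
  assumes "X \<in> Cells0 B" "Y \<in> Cells0 B" "Z \<in> Cells0 B"
    and "G \<in> Obj (HomCat B Y Z)" "\<alpha> \<in> hom (HomCat B X Y) F F'"
  shows "whisker_left B X Y Z G \<alpha> \<in> hom (HomCat B X Z) (hcomp1 B X Y Z G F) (hcomp1 B X Y Z G F')"
  unfolding whisker_left_def
  using hcomp2_hom[OF assms(1-3,5)] category.Ident_hom[OF HomCat_category] assms by blast

lemma whisker_right_hom:
  assumes "X \<in> Cells0 B" "Y \<in> Cells0 B" "Z \<in> Cells0 B"
    and "F \<in> Obj (HomCat B X Y)" "\<beta> \<in> hom (HomCat B Y Z) G G'"
  shows "whisker_right B X Y Z \<beta> F \<in> hom (HomCat B X Z) (hcomp1 B X Y Z G F) (hcomp1 B X Y Z G' F)"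
  unfolding whisker_right_def
  using hcomp2_hom[OF assms(1-3) _ assms(5)] category.Ident_hom[OF HomCat_category] assms by blast

lemma whisker_left_inverse_arrows:
  assumes "X \<in> Cells0 B" "Y \<in> Cells0 B" "Z \<in> Cells0 B"
    and "G \<in> Obj (HomCat B Y Z)" "inverse_arrows (HomCat B X Y) \<alpha> \<alpha>'"
  shows "inverse_arrows (HomCat B X Z) (whisker_left B X Y Z G \<alpha>) (whisker_left B X Y Z G \<alpha>')"
  unfolding whisker_left_def using assms by (intro hcomp2_inverse_arrows inverse_arrows_Ident)

lemma whisker_right_inverse_arrows:
  assumes "X \<in> Cells0 B" "Y \<in> Cells0 B" "Z \<in> Cells0 B"
    and "F \<in> Obj (HomCat B X Y)" "inverse_arrows (HomCat B Y Z) \<beta> \<beta>'"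
  shows "inverse_arrows (HomCat B X Z) (whisker_right B X Y Z \<beta> F) (whisker_right B X Y Z \<beta>' F)"
  unfolding whisker_right_def using assms by (intro hcomp2_inverse_arrows inverse_arrows_Ident)

lemma assoc_hom_iso:
  assumes "W \<in> Cells0 B" "X \<in> Cells0 B" "Y \<in> Cells0 B" "Z \<in> Cells0 B"
    and "F \<in> Obj (HomCat B W X)" "G \<in> Obj (HomCat B X Y)" "H \<in> Obj (HomCat B Y Z)"
  shows "assoc B W X Y Z H G F \<in> hom (HomCat B W Z)
           (hcomp1 B W X Z (hcomp1 B X Y Z H G) F) (hcomp1 B W Y Z H (hcomp1 B W X Y G F))
         \<and> is_iso (HomCat B W Z) (assoc B W X Y Z H G F)"
  using assoc_natural_iso[OF assms(1-4)] assms(5-)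
  unfolding natural_iso_def by (auto simp: prod_cat_def)

lemma lunit_hom_iso:
  assumes "X \<in> Cells0 B" "Y \<in> Cells0 B" "F \<in> Obj (HomCat B X Y)"
  shows "lunit B X Y F \<in> hom (HomCat B X Y) (hcomp1 B X Y Y (unit1 B Y) F) F
         \<and> is_iso (HomCat B X Y) (lunit B X Y F)"
  using lunit_natural_iso[OF assms(1,2)] assms(3) unfolding natural_iso_def by auto

lemma runit_hom_iso:
  assumes "X \<in> Cells0 B" "Y \<in> Cells0 B" "F \<in> Obj (HomCat B X Y)"
  shows "runit B X Y F \<in> hom (HomCat B X Y) (hcomp1 B X X Y F (unit1 B X)) F
         \<and> is_iso (HomCat B X Y) (runit B X Y F)"
  using runit_natural_iso[OF assms(1,2)] assms(3) unfolding natural_iso_def by auto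

end


section \<open>Shadows\<close>

text \<open>
  An object (arrow) of the coproduct of the endo-hom-categories is a pair of a 0-cell \<open>X\<close> and an
  object (arrow) of \<open>B(X,X)\<close>. For \<open>F : X \<rightarrow> Y\<close> and \<open>G : Y \<rightarrow> X\<close>, \<open>theta X Y F G\<close> is the
  isomorphism from the shadow of \<open>FG\<close> to the shadow of \<open>GF\<close>.
\<close>

record ('o, 'f, 't, 'd, 'e) shadow_data =
  sh_obj :: "'o \<times> 'f \<Rightarrow> 'd"
  sh_arr :: "'o \<times> 't \<Rightarrow> 'e"
  theta :: "'o \<Rightarrow> 'o \<Rightarrow> 'f \<Rightarrow> 'f \<Rightarrow> 'e"

text \<open>
  In the hexagon, the arrows labelled \<open>a\<close> going from \<open>H(GF)\<close> to \<open>(HG)F\<close> and from \<open>F(HG)\<close> to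
  \<open>(FH)G\<close> are inverses of associators.
\<close>

locale shadow = B: bicategory B + D: category D
  for B :: "('o, 'f, 't) bicat" and D :: "('d, 'e) cat" (structure) +
  fixes S :: "('o, 'f, 't, 'd, 'e) shadow_data"
  assumes sh_functor:
      "is_functor (coprod_cat (Cells0 B) (\<lambda>X. HomCat B X X)) D (sh_obj S) (sh_arr S)"
    and theta_natural_iso:
      "X \<in> Cells0 B \<Longrightarrow> Y \<in> Cells0 B \<Longrightarrow>
       natural_iso (HomCat B X Y \<times>\<^sub>C HomCat B Y X) D
         (\<lambda>(F, G). sh_obj S (Y, hcomp1 B Y X Y F G)) (\<lambda>(\<alpha>, \<beta>). sh_arr S (Y, hcomp2 B Y X Y \<alpha> \<beta>))
         (\<lambda>(F, G). sh_obj S (X, hcomp1 B X Y X G F)) (\<lambda>(\<alpha>, \<beta>). sh_arr S (X, hcomp2 B X Y X \<beta> \<alpha>))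
         (\<lambda>(F, G). theta S X Y F G)"
    and hexagon:
      "X \<in> Cells0 B \<Longrightarrow> Y \<in> Cells0 B \<Longrightarrow> Z \<in> Cells0 B \<Longrightarrow>
       F \<in> Obj (HomCat B X Y) \<Longrightarrow> G \<in> Obj (HomCat B Y Z) \<Longrightarrow> H \<in> Obj (HomCat B Z X) \<Longrightarrow>
       sh_arr S (Z, assoc B Z X Y Z G F H) \<cdot> theta S Z X H (hcomp1 B X Y Z G F) =
       theta S Z Y (hcomp1 B Z X Y F H) G
         \<cdot> sh_arr S (Y, assoc_inv B Y Z X Y F H G)
         \<cdot> theta S Y X (hcomp1 B Y Z X H G) F
         \<cdot> sh_arr S (X, assoc_inv B X Y Z X H G F)"
    and theta_lunit:
      "X \<in> Cells0 B \<Longrightarrow> K \<in> Obj (HomCat B X X) \<Longrightarrow>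
       sh_arr S (X, lunit B X X K) \<cdot> theta S X X K (unit1 B X) = sh_arr S (X, runit B X X K)"
    and theta_runit:
      "X \<in> Cells0 B \<Longrightarrow> K \<in> Obj (HomCat B X X) \<Longrightarrow>
       sh_arr S (X, runit B X X K) \<cdot> theta S X X (unit1 B X) K = sh_arr S (X, lunit B X X K)"


section \<open>Adjunctions and Euler characteristics\<close>

locale adjunction = bicategory B
  for B :: "('o, 'f, 't) bicat" +
  fixes C D :: 'o and F G :: 'f and u c :: 't
  assumes C_in: "C \<in> Cells0 B"
    and D_in: "D \<in> Cells0 B"
    and F_in: "F \<in> Obj (HomCat B C D)"
    and G_in: "G \<in> Obj (HomCat B D C)"
    and u_hom: "u \<in> hom (HomCat B C C) (unit1 B C) (hcomp1 B C D C G F)"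
    and c_hom: "c \<in> hom (HomCat B D D) (hcomp1 B D C D F G) (unit1 B D)"
    and triangle_F:
      "lunit B C D F
         \<cdot>\<^bsub>HomCat B C D\<^esub> whisker_right B C D D c F
         \<cdot>\<^bsub>HomCat B C D\<^esub> assoc_inv B C D C D F G F
         \<cdot>\<^bsub>HomCat B C D\<^esub> whisker_left B C C D F u
         \<cdot>\<^bsub>HomCat B C D\<^esub> inv_arr (HomCat B C D) (runit B C D F) = Ident (HomCat B C D) F"
    and triangle_G:
      "runit B D C G
         \<cdot>\<^bsub>HomCat B D C\<^esub> whisker_left B D D C G c
         \<cdot>\<^bsub>HomCat B D C\<^esub> assoc B D C D C G F G
         \<cdot>\<^bsub>HomCat B D C\<^esub> whisker_right B D C C u G
         \<cdot>\<^bsub>HomCat B D C\<^esub> inv_arr (HomCat B D C) (lunit B D C G) = Ident (HomCat B D C) G"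

lemma (in category) inverse_Comp5:
  assumes eq: "e \<cdot> d \<cdot> c \<cdot> b \<cdot> a = Ident C x"
    and homs: "a \<in> hom C x x1" "b \<in> hom C x1 x2" "c \<in> hom C x2 x3" "d \<in> hom C x3 x4" "e \<in> hom C x4 x"
    and invs: "inverse_arrows C a a'" "inverse_arrows C b b'" "inverse_arrows C c c'"
              "inverse_arrows C d d'" "inverse_arrows C e e'"
  shows "a' \<cdot> b' \<cdot> c' \<cdot> d' \<cdot> e' = Ident C x"
proof -
  have homs': "a' \<in> hom C x1 x" "b' \<in> hom C x2 x1" "c' \<in> hom C x3 x2" "d' \<in> hom C x4 x3"
              "e' \<in> hom C x x4"
    using homs invs by (auto dest: inverse_arrows_homD)
  have x: "x \<in> Obj C" using homs(1) Dom_in unfolding hom_def by auto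
  note invs' = invs[THEN inverse_arrows_sym]
  note ab = Comp_hom[OF homs'(2,1)] and ba = Comp_hom[OF homs(1,2)]
  note abc = Comp_hom[OF homs'(3) ab] and cba = Comp_hom[OF ba homs(3)]
  note abcd = Comp_hom[OF homs'(4) abc]
  note inv2 = inverse_arrows_Comp[OF invs'(2,1) homs'(2,1)]
  note inv3 = inverse_arrows_Comp[OF invs'(3) inv2 homs'(3) ab]
  note inv4 = inverse_arrows_Comp[OF invs'(4) inv3 homs'(4) abc]
  note inv5 = inverse_arrows_Comp[OF invs'(5) inv4 homs'(5) abcd]
  have "e \<cdot> (d \<cdot> (c \<cdot> (b \<cdot> a))) = e \<cdot> d \<cdot> c \<cdot> b \<cdot> a"
    using Comp_assoc[OF homs(1,2)] Comp_assoc[OF ba homs(3,4)] Comp_assoc[OF cba homs(4,5)]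
      Comp_assoc[OF ba homs(3) Comp_hom[OF homs(4,5)]]
      Comp_assoc[OF homs(1,2) Comp_hom[OF homs(3) Comp_hom[OF homs(4,5)]]]
    by simp
  then have "inverse_arrows C (Ident C x) (a' \<cdot> b' \<cdot> c' \<cdot> d' \<cdot> e')"
    using inverse_arrows_sym[OF inv5] eq by simp
  moreover have "inverse_arrows C (Ident C x) (Ident C x)"
    unfolding inverse_arrows_def using Ident_hom[OF x] Ident_left by blast
  ultimately show ?thesis using inverse_arrows_unique by blast
qed

text \<open>An adjoint equivalence can be reversed, so that \<open>\<chi>(G)\<close> below is the Euler characteristic of
  an adjunction.\<close>

lemma (in adjunction) reverse_adjunction:
  assumes u: "is_iso (HomCat B C C) u" and c: "is_iso (HomCat B D D) c"
  shows "adjunction B D C G F (inv_arr (HomCat B D D) c) (inv_arr (HomCat B C C) u)"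
proof -
  interpret CC: category "HomCat B C C" using HomCat_category C_in by blast
  interpret DD: category "HomCat B D D" using HomCat_category D_in by blast
  interpret CD: category "HomCat B C D" using HomCat_category C_in D_in by blast
  interpret DC: category "HomCat B D C" using HomCat_category C_in D_in by blast
  note inu = CC.inverse_arrows_inv_arr[OF u] and inc = DD.inverse_arrows_inv_arr[OF c]
  have u': "inv_arr (HomCat B C C) u \<in> hom (HomCat B C C) (hcomp1 B C D C G F) (unit1 B C)"
    using CC.inverse_arrows_homD[OF inu u_hom] by blast
  have c': "inv_arr (HomCat B D D) c \<in> hom (HomCat B D D) (unit1 B D) (hcomp1 B D C D F G)"
    using DD.inverse_arrows_homD[OF inc c_hom] by blast
  note lF = lunit_hom_iso[OF C_in D_in F_in] and rF = runit_hom_iso[OF C_in D_in F_in]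
  note lG = lunit_hom_iso[OF D_in C_in G_in] and rG = runit_hom_iso[OF D_in C_in G_in]
  note aF = assoc_hom_iso[OF C_in D_in C_in D_in F_in G_in F_in]
  note aG = assoc_hom_iso[OF D_in C_in D_in C_in G_in F_in G_in]
  note ilF = CD.inverse_arrows_inv_arr[OF conjunct2[OF lF]]
  note irF = CD.inverse_arrows_inv_arr[OF conjunct2[OF rF]]
  note ilG = DC.inverse_arrows_inv_arr[OF conjunct2[OF lG]]
  note irG = DC.inverse_arrows_inv_arr[OF conjunct2[OF rG]]
  note iaF = CD.inverse_arrows_inv_arr[OF conjunct2[OF aF], folded assoc_inv_def]
  note iaG = DC.inverse_arrows_inv_arr[OF conjunct2[OF aG], folded assoc_inv_def]
  have "runit B C D F
         \<cdot>\<^bsub>HomCat B C D\<^esub> whisker_left B C C D F (inv_arr (HomCat B C C) u)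
         \<cdot>\<^bsub>HomCat B C D\<^esub> assoc B C D C D F G F
         \<cdot>\<^bsub>HomCat B C D\<^esub> whisker_right B C D D (inv_arr (HomCat B D D) c) F
         \<cdot>\<^bsub>HomCat B C D\<^esub> inv_arr (HomCat B C D) (lunit B C D F) = Ident (HomCat B C D) F"
    by (rule CD.inverse_Comp5[OF triangle_F
          CD.inverse_arrows_homD[OF irF conjunct1[OF rF], THEN conjunct1]
          whisker_left_hom[OF C_in C_in D_in F_in u_hom]
          CD.inverse_arrows_homD[OF iaF conjunct1[OF aF], THEN conjunct1]
          whisker_right_hom[OF C_in D_in D_in F_in c_hom]
          conjunct1[OF lF]
          inverse_arrows_sym[OF irF]
          whisker_left_inverse_arrows[OF C_in C_in D_in F_in inu]
          inverse_arrows_sym[OF iaF]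
          whisker_right_inverse_arrows[OF C_in D_in D_in F_in inc] ilF])
  moreover have "lunit B D C G
         \<cdot>\<^bsub>HomCat B D C\<^esub> whisker_right B D C C (inv_arr (HomCat B C C) u) G
         \<cdot>\<^bsub>HomCat B D C\<^esub> assoc_inv B D C D C G F G
         \<cdot>\<^bsub>HomCat B D C\<^esub> whisker_left B D D C G (inv_arr (HomCat B D D) c)
         \<cdot>\<^bsub>HomCat B D C\<^esub> inv_arr (HomCat B D C) (runit B D C G) = Ident (HomCat B D C) G"
    by (rule DC.inverse_Comp5[OF triangle_G
          DC.inverse_arrows_homD[OF ilG conjunct1[OF lG], THEN conjunct1]
          whisker_right_hom[OF D_in C_in C_in G_in u_hom]
          conjunct1[OF aG]
          whisker_left_hom[OF D_in D_in C_in G_in c_hom]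
          conjunct1[OF rG]
          inverse_arrows_sym[OF ilG]
          whisker_right_inverse_arrows[OF D_in C_in C_in G_in inu]
          iaG
          whisker_left_inverse_arrows[OF D_in D_in C_in G_in inc] irG])
  ultimately show ?thesis
    by unfold_locales (use C_in D_in F_in G_in u' c' in auto)
qed

text \<open>The third argument is the shadow; the remaining ones are the data of an adjunction.\<close>

definition euler_char ::
    "('o, 'f, 't) bicat \<Rightarrow> ('d, 'e) cat \<Rightarrow> ('o, 'f, 't, 'd, 'e) shadow_data \<Rightarrow>
     'o \<Rightarrow> 'o \<Rightarrow> 'f \<Rightarrow> 'f \<Rightarrow> 't \<Rightarrow> 't \<Rightarrow> 'e" where
  "euler_char B V S C D F G u c =
     sh_arr S (D, c) \<cdot>\<^bsub>V\<^esub> theta S D C G F \<cdot>\<^bsub>V\<^esub> sh_arr S (C, u)"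

end

theory Submission
  imports Defs
begin

text \<open>
  After cancelling \<open>\<langle>\<langle>c\<^sup>-\<^sup>1\<rangle>\<rangle>\<langle>\<langle>c\<rangle>\<rangle>\<close>, the composite \<open>\<chi>(G)\<chi>(F)\<close> is
  \<open>\<langle>\<langle>u\<^sup>-\<^sup>1\<rangle>\<rangle> \<theta> \<theta> \<langle>\<langle>u\<rangle>\<rangle>\<close>, where the two instances of \<open>\<theta>\<close> go from
  \<open>\<langle>\<langle>GF\<rangle>\<rangle>\<close> to \<open>\<langle>\<langle>FG\<rangle>\<rangle>\<close> and back; the other composite has the same shape.
  Everything therefore rests on the fact that \<open>\<theta>\<close> is an involution (\<open>theta_theta\<close> below),
  which is not among the axioms of a shadow but follows from them.

  To see this, put \<open>H = U\<close> in the hexagon. One side is a rotation \<open>\<theta>\<close> of the unit past \<open>GF\<close>, which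
  the unit axiom of the shadow turns into unitors; the other side contains the two rotations of
  \<open>GF\<close>. Naturality of \<open>\<theta>\<close> strips the unit off these rotations, and the three associators
  in the hexagon, which have the unit in their first, second and third place, disappear against
  unitors. For the middle place this is the triangle axiom. For the outer places it is Kelly's
  observation that the triangles
  \<open>l \<circ> a = l F : (UG)F \<Rightarrow> GF\<close> and \<open>G r \<circ> a = r : (GF)U \<Rightarrow> GF\<close> follow from the
  pentagon and the middle triangle (\<open>lunit_hcomp1\<close> and \<open>runit_hcomp1\<close>).
\<close>

section \<open>Composition with isomorphisms\<close>

context category
begin

lemma is_iso_cancel_right:
  assumes e: "is_iso C e" "e \<in> hom C x y" and f: "f \<in> hom C y z" and g: "g \<in> hom C y z"
    and eq: "f \<cdot> e = g \<cdot> e"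
  shows "f = g"
proof -
  note e' = inverse_arrows_homD[OF inverse_arrows_inv_arr[OF e(1)] e(2)]
  have "f = (f \<cdot> e) \<cdot> inv_arr C e"
    using Comp_assoc[OF conjunct1[OF e'] e(2) f] e' Ident_right[OF f] by simp
  also have "\<dots> = g"
    using Comp_assoc[OF conjunct1[OF e'] e(2) g] e' Ident_right[OF g] eq by simp
  finally show ?thesis .
qed

lemma is_iso_cancel_left:
  assumes e: "is_iso C e" "e \<in> hom C y z" and f: "f \<in> hom C x y" and g: "g \<in> hom C x y"
    and eq: "e \<cdot> f = e \<cdot> g"
  shows "f = g"
proof -
  note e' = inverse_arrows_homD[OF inverse_arrows_inv_arr[OF e(1)] e(2)]
  have "f = inv_arr C e \<cdot> (e \<cdot> f)"
    using Comp_assoc[OF f e(2) conjunct1[OF e']] e' Ident_left[OF f] by simp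
  also have "\<dots> = g"
    using Comp_assoc[OF g e(2) conjunct1[OF e']] e' Ident_left[OF g] eq by simp
  finally show ?thesis .
qed

lemma is_iso_Comp:
  assumes "is_iso C f" "is_iso C g" "f \<in> hom C x y" "g \<in> hom C y z"
  shows "is_iso C (g \<cdot> f)"
  using inverse_arrows_Comp assms unfolding is_iso_def by blast

end


section \<open>Whiskering\<close>

context bicategory
begin

lemma hcomp2_Comp:
  assumes "X \<in> Cells0 B" "Y \<in> Cells0 B" "Z \<in> Cells0 B"
    and "\<alpha> \<in> hom (HomCat B X Y) F F'" "\<alpha>' \<in> hom (HomCat B X Y) F' F''"
    and "\<beta> \<in> hom (HomCat B Y Z) G G'" "\<beta>' \<in> hom (HomCat B Y Z) G' G''"
  shows "hcomp2 B X Y Z (\<beta>' \<cdot>\<^bsub>HomCat B Y Z\<^esub> \<beta>) (\<alpha>' \<cdot>\<^bsub>HomCat B X Y\<^esub> \<alpha>)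
       = hcomp2 B X Y Z \<beta>' \<alpha>' \<cdot>\<^bsub>HomCat B X Z\<^esub> hcomp2 B X Y Z \<beta> \<alpha>"
  using hcomp_functor[OF assms(1-3)] assms(4-)
  unfolding is_functor_def by (force simp: prod_cat_def hom_def)

lemma hcomp2_Ident:
  assumes "X \<in> Cells0 B" "Y \<in> Cells0 B" "Z \<in> Cells0 B"
    and "F \<in> Obj (HomCat B X Y)" "G \<in> Obj (HomCat B Y Z)"
  shows "hcomp2 B X Y Z (Ident (HomCat B Y Z) G) (Ident (HomCat B X Y) F)
       = Ident (HomCat B X Z) (hcomp1 B X Y Z G F)"
  using hcomp_functor[OF assms(1-3)] assms(4-)
  unfolding is_functor_def by (force simp: prod_cat_def)

lemma whisker_left_Comp:
  assumes "X \<in> Cells0 B" "Y \<in> Cells0 B" "Z \<in> Cells0 B" and G: "G \<in> Obj (HomCat B Y Z)"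
    and "\<alpha> \<in> hom (HomCat B X Y) F F'" "\<alpha>' \<in> hom (HomCat B X Y) F' F''"
  shows "whisker_left B X Y Z G (\<alpha>' \<cdot>\<^bsub>HomCat B X Y\<^esub> \<alpha>)
       = whisker_left B X Y Z G \<alpha>' \<cdot>\<^bsub>HomCat B X Z\<^esub> whisker_left B X Y Z G \<alpha>"
proof -
  interpret YZ: category "HomCat B Y Z" using HomCat_category assms by blast
  note i = YZ.Ident_hom[OF G]
  show ?thesis
    unfolding whisker_left_def
    using hcomp2_Comp[OF assms(1-3,5,6) i i] YZ.Ident_left[OF i] by simp
qed

lemma whisker_right_Comp:
  assumes "X \<in> Cells0 B" "Y \<in> Cells0 B" "Z \<in> Cells0 B" and F: "F \<in> Obj (HomCat B X Y)"
    and "\<beta> \<in> hom (HomCat B Y Z) G G'" "\<beta>' \<in> hom (HomCat B Y Z) G' G''"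
  shows "whisker_right B X Y Z (\<beta>' \<cdot>\<^bsub>HomCat B Y Z\<^esub> \<beta>) F
       = whisker_right B X Y Z \<beta>' F \<cdot>\<^bsub>HomCat B X Z\<^esub> whisker_right B X Y Z \<beta> F"
proof -
  interpret XY: category "HomCat B X Y" using HomCat_category assms by blast
  note i = XY.Ident_hom[OF F]
  show ?thesis
    unfolding whisker_right_def
    using hcomp2_Comp[OF assms(1-3) i i assms(5,6)] XY.Ident_left[OF i] by simp
qed

lemma whisker_left_is_iso:
  assumes "X \<in> Cells0 B" "Y \<in> Cells0 B" "Z \<in> Cells0 B"
    and "G \<in> Obj (HomCat B Y Z)" "is_iso (HomCat B X Y) \<alpha>"
  shows "is_iso (HomCat B X Z) (whisker_left B X Y Z G \<alpha>)"
  using whisker_left_inverse_arrows[OF assms(1-4)] assms(5) unfolding is_iso_def by blast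

lemma whisker_right_is_iso:
  assumes "X \<in> Cells0 B" "Y \<in> Cells0 B" "Z \<in> Cells0 B"
    and "F \<in> Obj (HomCat B X Y)" "is_iso (HomCat B Y Z) \<beta>"
  shows "is_iso (HomCat B X Z) (whisker_right B X Y Z \<beta> F)"
  using whisker_right_inverse_arrows[OF assms(1-4)] assms(5) unfolding is_iso_def by blast

lemma assoc_natural:
  assumes "W \<in> Cells0 B" "X \<in> Cells0 B" "Y \<in> Cells0 B" "Z \<in> Cells0 B"
    and "\<alpha> \<in> hom (HomCat B W X) F F'" "\<beta> \<in> hom (HomCat B X Y) G G'"
    and "\<gamma> \<in> hom (HomCat B Y Z) H H'"
  shows "hcomp2 B W Y Z \<gamma> (hcomp2 B W X Y \<beta> \<alpha>) \<cdot>\<^bsub>HomCat B W Z\<^esub> assoc B W X Y Z H G F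
       = assoc B W X Y Z H' G' F' \<cdot>\<^bsub>HomCat B W Z\<^esub> hcomp2 B W X Z (hcomp2 B X Y Z \<gamma> \<beta>) \<alpha>"
proof -
  have "(\<gamma>, \<beta>, \<alpha>) \<in> Arr (HomCat B Y Z \<times>\<^sub>C HomCat B X Y \<times>\<^sub>C HomCat B W X)"
    using assms(5-7) by (simp add: prod_cat_def hom_def)
  from bspec[OF conjunct2[OF conjunct2[OF conjunct2[OF
      assoc_natural_iso[OF assms(1-4), unfolded natural_iso_def]]]] this]
  show ?thesis using assms(5-7) by (simp add: prod_cat_def hom_def)
qed

lemma assoc_whisker_inner:
  assumes "W \<in> Cells0 B" "X \<in> Cells0 B" "Y \<in> Cells0 B" "Z \<in> Cells0 B"
    and \<alpha>: "\<alpha> \<in> hom (HomCat B W X) F F'"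
    and G: "G \<in> Obj (HomCat B X Y)" and H: "H \<in> Obj (HomCat B Y Z)"
  shows "whisker_left B W Y Z H (whisker_left B W X Y G \<alpha>)
           \<cdot>\<^bsub>HomCat B W Z\<^esub> assoc B W X Y Z H G F
       = assoc B W X Y Z H G F' \<cdot>\<^bsub>HomCat B W Z\<^esub> whisker_left B W X Z (hcomp1 B X Y Z H G) \<alpha>"
  using assoc_natural[OF assms(1-4) \<alpha>
      category.Ident_hom[OF HomCat_category[OF assms(2,3)] G]
      category.Ident_hom[OF HomCat_category[OF assms(3,4)] H]]
  by (simp add: whisker_left_def hcomp2_Ident[OF assms(2-4) G H])

lemma assoc_whisker_middle:
  assumes "W \<in> Cells0 B" "X \<in> Cells0 B" "Y \<in> Cells0 B" "Z \<in> Cells0 B"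
    and F: "F \<in> Obj (HomCat B W X)"
    and \<beta>: "\<beta> \<in> hom (HomCat B X Y) G G'" and H: "H \<in> Obj (HomCat B Y Z)"
  shows "whisker_left B W Y Z H (whisker_right B W X Y \<beta> F)
           \<cdot>\<^bsub>HomCat B W Z\<^esub> assoc B W X Y Z H G F
       = assoc B W X Y Z H G' F \<cdot>\<^bsub>HomCat B W Z\<^esub> whisker_right B W X Z (whisker_left B X Y Z H \<beta>) F"
  using assoc_natural[OF assms(1-4)
      category.Ident_hom[OF HomCat_category[OF assms(1,2)] F] \<beta>
      category.Ident_hom[OF HomCat_category[OF assms(3,4)] H]]
  by (simp add: whisker_left_def whisker_right_def)

lemma assoc_whisker_outer:
  assumes "W \<in> Cells0 B" "X \<in> Cells0 B" "Y \<in> Cells0 B" "Z \<in> Cells0 B"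
    and F: "F \<in> Obj (HomCat B W X)"
    and G: "G \<in> Obj (HomCat B X Y)" and \<gamma>: "\<gamma> \<in> hom (HomCat B Y Z) H H'"
  shows "whisker_right B W Y Z \<gamma> (hcomp1 B W X Y G F)
           \<cdot>\<^bsub>HomCat B W Z\<^esub> assoc B W X Y Z H G F
       = assoc B W X Y Z H' G F \<cdot>\<^bsub>HomCat B W Z\<^esub> whisker_right B W X Z (whisker_right B X Y Z \<gamma> G) F"
  using assoc_natural[OF assms(1-4)
      category.Ident_hom[OF HomCat_category[OF assms(1,2)] F]
      category.Ident_hom[OF HomCat_category[OF assms(2,3)] G] \<gamma>]
  by (simp add: whisker_right_def hcomp2_Ident[OF assms(1-3) F G])

text \<open>By naturality of the unitors, whiskering with a unit is conjugate to the identity functor,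
  hence faithful.\<close>

lemma whisker_left_unit1_cancel:
  assumes X: "X \<in> Cells0 B" and Y: "Y \<in> Cells0 B"
    and \<alpha>: "\<alpha> \<in> hom (HomCat B X Y) F F'" and \<beta>: "\<beta> \<in> hom (HomCat B X Y) F F'"
    and eq: "whisker_left B X Y Y (unit1 B Y) \<alpha> = whisker_left B X Y Y (unit1 B Y) \<beta>"
  shows "\<alpha> = \<beta>"
proof -
  interpret XY: category "HomCat B X Y" using HomCat_category[OF X Y] .
  have F: "F \<in> Obj (HomCat B X Y)" using \<alpha> XY.Dom_in by (auto simp: hom_def)
  have nat: "\<delta> \<cdot>\<^bsub>HomCat B X Y\<^esub> lunit B X Y F
      = lunit B X Y F' \<cdot>\<^bsub>HomCat B X Y\<^esub> whisker_left B X Y Y (unit1 B Y) \<delta>"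
    if "\<delta> \<in> hom (HomCat B X Y) F F'" for \<delta>
    using lunit_natural_iso[OF X Y] that by (auto simp: natural_iso_def hom_def)
  note l = lunit_hom_iso[OF X Y F]
  show ?thesis
    using XY.is_iso_cancel_right[OF conjunct2[OF l] conjunct1[OF l] \<alpha> \<beta>] nat[OF \<alpha>] nat[OF \<beta>] eq
    by simp
qed

lemma whisker_right_unit1_cancel:
  assumes X: "X \<in> Cells0 B" and Y: "Y \<in> Cells0 B"
    and \<alpha>: "\<alpha> \<in> hom (HomCat B X Y) F F'" and \<beta>: "\<beta> \<in> hom (HomCat B X Y) F F'"
    and eq: "whisker_right B X X Y \<alpha> (unit1 B X) = whisker_right B X X Y \<beta> (unit1 B X)"
  shows "\<alpha> = \<beta>"
proof -
  interpret XY: category "HomCat B X Y" using HomCat_category[OF X Y] .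
  have F: "F \<in> Obj (HomCat B X Y)" using \<alpha> XY.Dom_in by (auto simp: hom_def)
  have nat: "\<delta> \<cdot>\<^bsub>HomCat B X Y\<^esub> runit B X Y F
      = runit B X Y F' \<cdot>\<^bsub>HomCat B X Y\<^esub> whisker_right B X X Y \<delta> (unit1 B X)"
    if "\<delta> \<in> hom (HomCat B X Y) F F'" for \<delta>
    using runit_natural_iso[OF X Y] that by (auto simp: natural_iso_def hom_def)
  note r = runit_hom_iso[OF X Y F]
  show ?thesis
    using XY.is_iso_cancel_right[OF conjunct2[OF r] conjunct1[OF r] \<alpha> \<beta>] nat[OF \<alpha>] nat[OF \<beta>] eq
    by simp
qed


section \<open>Kelly's triangles\<close>

text \<open>
  In the pentagon for \<open>U, U, G, F\<close>, attach the triangle axiom to the two associators that have the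
  unit in the middle. Naturality of the associator identifies the two boundary paths, and what
  remains is the wanted triangle whiskered with \<open>U\<close>, precomposed with isomorphisms.
\<close>

lemma lunit_hcomp1:
  assumes X: "X \<in> Cells0 B" and Y: "Y \<in> Cells0 B" and Z: "Z \<in> Cells0 B"
    and F: "F \<in> Obj (HomCat B X Y)" and G: "G \<in> Obj (HomCat B Y Z)"
  shows "lunit B X Z (hcomp1 B X Y Z G F)
           \<cdot>\<^bsub>HomCat B X Z\<^esub> assoc B X Y Z Z (unit1 B Z) G F
       = whisker_right B X Y Z (lunit B Y Z G) F"
proof -
  interpret XZ: category "HomCat B X Z" using HomCat_category[OF X Z] .
  let ?U = "unit1 B Z"
  let ?GF = "hcomp1 B X Y Z G F"
  let ?UG = "hcomp1 B Y Z Z ?U G"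
  note U = unit1_in[OF Z]
  note UU = hcomp1_in[OF Z Z Z U U]
  note GF = hcomp1_in[OF X Y Z F G]
  note UG = hcomp1_in[OF Y Z Z G U]
  note lG = conjunct1[OF lunit_hom_iso[OF Y Z G]]
  note lGF = conjunct1[OF lunit_hom_iso[OF X Z GF]]
  note rU = conjunct1[OF runit_hom_iso[OF Z Z U]]
  note aUUG = assoc_hom_iso[OF Y Z Z Z G U U]
  define a where "a = assoc B X Y Z Z ?U G F"
  define p where "p = whisker_right B X Y Z (assoc B Y Z Z Z ?U ?U G) F"
  define q where "q = assoc B X Y Z Z ?U ?UG F"
  define s where "s = whisker_left B X Z Z ?U a"
  define t where "t = assoc B X Y Z Z (hcomp1 B Z Z Z ?U ?U) G F"
  define v where "v = assoc B X Z Z Z ?U ?U ?GF"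
  define l where "l = whisker_left B X Z Z ?U (lunit B X Z ?GF)"
  define \<rho> where "\<rho> = whisker_right B X Z Z (runit B Z Z ?U) ?GF"
  define m where "m = whisker_right B X Y Z (whisker_left B Y Z Z ?U (lunit B Y Z G)) F"
  define n where "n = whisker_left B X Z Z ?U (whisker_right B X Y Z (lunit B Y Z G) F)"
  note a = conjunct1[OF assoc_hom_iso[OF X Y Z Z F G U], folded a_def]
  note p = whisker_right_hom[OF X Y Z F conjunct1[OF aUUG], folded p_def]
  note q = conjunct1[OF assoc_hom_iso[OF X Y Z Z F UG U], folded q_def]
  note s = whisker_left_hom[OF X Z Z U a, folded s_def]
  note t = conjunct1[OF assoc_hom_iso[OF X Y Z Z F G UU], folded t_def]
  note v = conjunct1[OF assoc_hom_iso[OF X Z Z Z GF U U], folded v_def]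
  note l = whisker_left_hom[OF X Z Z U lGF, folded l_def]
  note \<rho> = whisker_right_hom[OF X Z Z GF rU, folded \<rho>_def]
  note m = whisker_right_hom[OF X Y Z F whisker_left_hom[OF Y Z Z U lG], folded m_def]
  note n = whisker_left_hom[OF X Z Z U whisker_right_hom[OF X Y Z F lG], folded n_def]
  note homs = a p q s t v l \<rho> m n
  have pent: "v \<cdot>\<^bsub>HomCat B X Z\<^esub> t = s \<cdot>\<^bsub>HomCat B X Z\<^esub> q \<cdot>\<^bsub>HomCat B X Z\<^esub> p"
    using pentagon[OF X Y Z Z Z F G U U] by (simp add: v_def t_def s_def q_def p_def a_def)
  have tri: "l \<cdot>\<^bsub>HomCat B X Z\<^esub> v = \<rho>"
    using triangle[OF X Z Z GF U] by (simp add: l_def v_def \<rho>_def)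
  have mp: "m \<cdot>\<^bsub>HomCat B X Z\<^esub> p
      = whisker_right B X Y Z (whisker_right B Y Z Z (runit B Z Z ?U) G) F"
    using whisker_right_Comp[OF X Y Z F conjunct1[OF aUUG] whisker_left_hom[OF Y Z Z U lG]]
      triangle[OF Y Z Z G U]
    by (simp add: m_def p_def)
  have nat1: "\<rho> \<cdot>\<^bsub>HomCat B X Z\<^esub> t = a \<cdot>\<^bsub>HomCat B X Z\<^esub> (m \<cdot>\<^bsub>HomCat B X Z\<^esub> p)"
    unfolding mp using assoc_whisker_outer[OF X Y Z Z F G rU] by (simp add: \<rho>_def t_def a_def)
  have nat2: "n \<cdot>\<^bsub>HomCat B X Z\<^esub> q = a \<cdot>\<^bsub>HomCat B X Z\<^esub> m"
    using assoc_whisker_middle[OF X Y Z Z F lG U] by (simp add: n_def q_def a_def m_def)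
  have "(l \<cdot>\<^bsub>HomCat B X Z\<^esub> s) \<cdot>\<^bsub>HomCat B X Z\<^esub> (q \<cdot>\<^bsub>HomCat B X Z\<^esub> p)
      = l \<cdot>\<^bsub>HomCat B X Z\<^esub> (v \<cdot>\<^bsub>HomCat B X Z\<^esub> t)"
    unfolding pent
    using XZ.Comp_assoc[OF XZ.Comp_hom[OF p q] s l] XZ.Comp_assoc[OF p q s] by simp
  also have "\<dots> = a \<cdot>\<^bsub>HomCat B X Z\<^esub> (m \<cdot>\<^bsub>HomCat B X Z\<^esub> p)"
    using XZ.Comp_assoc[OF t v l] tri nat1 by simp
  also have "\<dots> = n \<cdot>\<^bsub>HomCat B X Z\<^esub> (q \<cdot>\<^bsub>HomCat B X Z\<^esub> p)"
    using XZ.Comp_assoc[OF p m a] XZ.Comp_assoc[OF p q n] nat2 by simp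
  finally have "l \<cdot>\<^bsub>HomCat B X Z\<^esub> s = n"
    by (rule XZ.is_iso_cancel_right[rotated -1])
      (use p q s l n XZ.is_iso_Comp[OF _ _ p q] XZ.Comp_hom
        whisker_right_is_iso[OF X Y Z F conjunct2[OF aUUG], folded p_def]
        conjunct2[OF assoc_hom_iso[OF X Y Z Z F UG U], folded q_def] in blast)+
  then have "whisker_left B X Z Z ?U (lunit B X Z ?GF \<cdot>\<^bsub>HomCat B X Z\<^esub> a)
      = whisker_left B X Z Z ?U (whisker_right B X Y Z (lunit B Y Z G) F)"
    using whisker_left_Comp[OF X Z Z U a lGF] by (simp add: l_def s_def n_def)
  from whisker_left_unit1_cancel[OF X Z XZ.Comp_hom[OF a lGF] whisker_right_hom[OF X Y Z F lG] this]
  show ?thesis by (simp add: a_def)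
qed

text \<open>The mirror image: here the pentagon is that of \<open>G, F, U, U\<close>, and the associator to cancel
  stands on the left.\<close>

lemma runit_hcomp1:
  assumes X: "X \<in> Cells0 B" and Y: "Y \<in> Cells0 B" and Z: "Z \<in> Cells0 B"
    and F: "F \<in> Obj (HomCat B X Y)" and G: "G \<in> Obj (HomCat B Y Z)"
  shows "whisker_left B X Y Z G (runit B X Y F)
           \<cdot>\<^bsub>HomCat B X Z\<^esub> assoc B X X Y Z G F (unit1 B X)
       = runit B X Z (hcomp1 B X Y Z G F)"
proof -
  interpret XZ: category "HomCat B X Z" using HomCat_category[OF X Z] .
  let ?U = "unit1 B X"
  let ?GF = "hcomp1 B X Y Z G F"
  let ?FU = "hcomp1 B X X Y F ?U"
  note U = unit1_in[OF X]
  note UU = hcomp1_in[OF X X X U U]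
  note GF = hcomp1_in[OF X Y Z F G]
  note FU = hcomp1_in[OF X X Y U F]
  note rF = conjunct1[OF runit_hom_iso[OF X Y F]]
  note rGF = conjunct1[OF runit_hom_iso[OF X Z GF]]
  note lU = conjunct1[OF lunit_hom_iso[OF X X U]]
  note aFUU = conjunct1[OF assoc_hom_iso[OF X X X Y U U F]]
  define a where "a = assoc B X X Y Z G F ?U"
  define p where "p = whisker_right B X X Z a ?U"
  define q where "q = assoc B X X Y Z G ?FU ?U"
  define s where "s = whisker_left B X Y Z G (assoc B X X X Y F ?U ?U)"
  define t where "t = assoc B X X X Z ?GF ?U ?U"
  define v where "v = assoc B X X Y Z G F (hcomp1 B X X X ?U ?U)"
  define l where "l = whisker_left B X Y Z G (whisker_left B X X Y F (lunit B X X ?U))"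
  define k where "k = whisker_left B X X Z ?GF (lunit B X X ?U)"
  define \<rho> where "\<rho> = whisker_right B X X Z (runit B X Z ?GF) ?U"
  define m where "m = whisker_left B X Y Z G (whisker_right B X X Y (runit B X Y F) ?U)"
  define n where "n = whisker_right B X X Z (whisker_left B X Y Z G (runit B X Y F)) ?U"
  note a = conjunct1[OF assoc_hom_iso[OF X X Y Z U F G], folded a_def]
  note p = whisker_right_hom[OF X X Z U a, folded p_def]
  note q = conjunct1[OF assoc_hom_iso[OF X X Y Z U FU G], folded q_def]
  note s = whisker_left_hom[OF X Y Z G aFUU, folded s_def]
  note t = conjunct1[OF assoc_hom_iso[OF X X X Z U U GF], folded t_def]
  note v = conjunct1[OF assoc_hom_iso[OF X X Y Z UU F G], folded v_def]
  note l = whisker_left_hom[OF X Y Z G whisker_left_hom[OF X X Y F lU], folded l_def]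
  note k = whisker_left_hom[OF X X Z GF lU, folded k_def]
  note \<rho> = whisker_right_hom[OF X X Z U rGF, folded \<rho>_def]
  note m = whisker_left_hom[OF X Y Z G whisker_right_hom[OF X X Y U rF], folded m_def]
  note n = whisker_right_hom[OF X X Z U whisker_left_hom[OF X Y Z G rF], folded n_def]
  have pent: "v \<cdot>\<^bsub>HomCat B X Z\<^esub> t = s \<cdot>\<^bsub>HomCat B X Z\<^esub> q \<cdot>\<^bsub>HomCat B X Z\<^esub> p"
    using pentagon[OF X X X Y Z U U F G] by (simp add: v_def t_def s_def q_def p_def a_def)
  have tri: "k \<cdot>\<^bsub>HomCat B X Z\<^esub> t = \<rho>"
    using triangle[OF X X Z U GF] by (simp add: k_def t_def \<rho>_def)
  have ls: "l \<cdot>\<^bsub>HomCat B X Z\<^esub> s = m"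
    using whisker_left_Comp[OF X Y Z G aFUU whisker_left_hom[OF X X Y F lU]]
      triangle[OF X X Y U F]
    by (simp add: l_def s_def m_def)
  have nat1: "l \<cdot>\<^bsub>HomCat B X Z\<^esub> v = a \<cdot>\<^bsub>HomCat B X Z\<^esub> k"
    using assoc_whisker_inner[OF X X Y Z lU F G] by (simp add: l_def v_def a_def k_def)
  have nat2: "m \<cdot>\<^bsub>HomCat B X Z\<^esub> q = a \<cdot>\<^bsub>HomCat B X Z\<^esub> n"
    using assoc_whisker_middle[OF X X Y Z U rF G] by (simp add: m_def q_def a_def n_def)
  have "a \<cdot>\<^bsub>HomCat B X Z\<^esub> \<rho> = l \<cdot>\<^bsub>HomCat B X Z\<^esub> (v \<cdot>\<^bsub>HomCat B X Z\<^esub> t)"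
    using XZ.Comp_assoc[OF t v l] XZ.Comp_assoc[OF t k a] tri nat1 by simp
  also have "\<dots> = (m \<cdot>\<^bsub>HomCat B X Z\<^esub> q) \<cdot>\<^bsub>HomCat B X Z\<^esub> p"
    unfolding pent
    using XZ.Comp_assoc[OF p XZ.Comp_hom[OF q s] l] XZ.Comp_assoc[OF q s l] ls by simp
  also have "\<dots> = a \<cdot>\<^bsub>HomCat B X Z\<^esub> (n \<cdot>\<^bsub>HomCat B X Z\<^esub> p)"
    using XZ.Comp_assoc[OF p n a] nat2 by simp
  finally have "\<rho> = n \<cdot>\<^bsub>HomCat B X Z\<^esub> p"
    by (rule XZ.is_iso_cancel_left[rotated -1])
      (use a \<rho> XZ.Comp_hom[OF p n]
        conjunct2[OF assoc_hom_iso[OF X X Y Z U F G], folded a_def] in blast)+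
  then have "whisker_right B X X Z
        (whisker_left B X Y Z G (runit B X Y F) \<cdot>\<^bsub>HomCat B X Z\<^esub> a) ?U
      = whisker_right B X X Z (runit B X Z ?GF) ?U"
    using whisker_right_Comp[OF X X Z U a whisker_left_hom[OF X Y Z G rF]]
    by (simp add: \<rho>_def n_def p_def)
  from whisker_right_unit1_cancel[OF X Z XZ.Comp_hom[OF a whisker_left_hom[OF X Y Z G rF]] rGF this]
  show ?thesis by (simp add: a_def)
qed

end


section \<open>The rotation of a shadow is an involution\<close>

context shadow
begin

lemma sh_arr_hom:
  assumes "X \<in> Cells0 B" "\<alpha> \<in> hom (HomCat B X X) F F'"
  shows "sh_arr S (X, \<alpha>) \<in> hom D (sh_obj S (X, F)) (sh_obj S (X, F'))"
  using sh_functor assms unfolding is_functor_def by (force simp: coprod_cat_def hom_def)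

lemma sh_arr_Comp:
  assumes "X \<in> Cells0 B" "\<alpha> \<in> hom (HomCat B X X) F F'" "\<beta> \<in> hom (HomCat B X X) F' F''"
  shows "sh_arr S (X, \<beta> \<cdot>\<^bsub>HomCat B X X\<^esub> \<alpha>) = sh_arr S (X, \<beta>) \<cdot> sh_arr S (X, \<alpha>)"
proof -
  let ?C = "coprod_cat (Cells0 B) (\<lambda>X. HomCat B X X)"
  have "(X, \<alpha>) \<in> Arr ?C" "(X, \<beta>) \<in> Arr ?C" "Cod ?C (X, \<alpha>) = Dom ?C (X, \<beta>)"
    using assms by (auto simp: coprod_cat_def hom_def)
  then have "sh_arr S ((X, \<beta>) \<cdot>\<^bsub>?C\<^esub> (X, \<alpha>)) = sh_arr S (X, \<beta>) \<cdot> sh_arr S (X, \<alpha>)"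
    using sh_functor unfolding is_functor_def by blast
  then show ?thesis by (simp add: coprod_cat_def)
qed

lemma sh_arr_inverse_arrows:
  assumes "X \<in> Cells0 B" "inverse_arrows (HomCat B X X) \<alpha> \<beta>"
  shows "inverse_arrows D (sh_arr S (X, \<alpha>)) (sh_arr S (X, \<beta>))"
proof -
  have "inverse_arrows (coprod_cat (Cells0 B) (\<lambda>X. HomCat B X X)) (X, \<alpha>) (X, \<beta>)"
    using assms by (fastforce simp: inverse_arrows_def coprod_cat_def hom_def)
  then show ?thesis by (rule is_functor_inverse_arrows[OF sh_functor])
qed

lemma theta_hom:
  assumes "X \<in> Cells0 B" "Y \<in> Cells0 B" "F \<in> Obj (HomCat B X Y)" "G \<in> Obj (HomCat B Y X)"
  shows "theta S X Y F G
       \<in> hom D (sh_obj S (Y, hcomp1 B Y X Y F G)) (sh_obj S (X, hcomp1 B X Y X G F))"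
  using theta_natural_iso[OF assms(1,2)] assms(3,4)
  unfolding natural_iso_def by (auto simp: prod_cat_def)

lemma theta_natural:
  assumes "X \<in> Cells0 B" "Y \<in> Cells0 B"
    and "\<alpha> \<in> hom (HomCat B X Y) F F'" "\<beta> \<in> hom (HomCat B Y X) G G'"
  shows "sh_arr S (X, hcomp2 B X Y X \<beta> \<alpha>) \<cdot> theta S X Y F G
       = theta S X Y F' G' \<cdot> sh_arr S (Y, hcomp2 B Y X Y \<alpha> \<beta>)"
proof -
  have "(\<alpha>, \<beta>) \<in> Arr (HomCat B X Y \<times>\<^sub>C HomCat B Y X)"
    using assms(3,4) by (simp add: prod_cat_def hom_def)
  from bspec[OF conjunct2[OF conjunct2[OF conjunct2[OF
      theta_natural_iso[OF assms(1,2), unfolded natural_iso_def]]]] this]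
  show ?thesis using assms(3,4) by (simp add: prod_cat_def hom_def)
qed

lemma theta_whisker_left:
  assumes "X \<in> Cells0 B" "Y \<in> Cells0 B"
    and "\<alpha> \<in> hom (HomCat B X Y) F F'" "G \<in> Obj (HomCat B Y X)"
  shows "sh_arr S (X, whisker_left B X Y X G \<alpha>) \<cdot> theta S X Y F G
       = theta S X Y F' G \<cdot> sh_arr S (Y, whisker_right B Y X Y \<alpha> G)"
  unfolding whisker_left_def whisker_right_def
  using theta_natural[OF assms(1-3)] assms category.Ident_hom[OF B.HomCat_category] by blast

text \<open>
  Consider the hexagon with \<open>H = U\<close>, precomposed with \<open>\<langle>\<langle>a\<rangle>\<rangle>\<close> and postcomposed with
  \<open>\<langle>\<langle>G r\<rangle>\<rangle>\<close>. The left side is then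
  \<open>\<langle>\<langle>l F\<rangle>\<rangle>\<close> itself by Kelly's triangles and the unit axiom, the right side is
  \<open>\<theta> \<theta> \<langle>\<langle>l F\<rangle>\<rangle>\<close> by naturality and the triangle axiom. As \<open>l F\<close> is invertible, it cancels.
\<close>

lemma theta_theta:
  assumes X: "X \<in> Cells0 B" and Y: "Y \<in> Cells0 B"
    and F: "F \<in> Obj (HomCat B X Y)" and G: "G \<in> Obj (HomCat B Y X)"
  shows "theta S X Y F G \<cdot> theta S Y X G F = Ident D (sh_obj S (X, hcomp1 B X Y X G F))"
proof -
  interpret XX: category "HomCat B X X" using B.HomCat_category[OF X X] .
  interpret YY: category "HomCat B Y Y" using B.HomCat_category[OF Y Y] .
  let ?U = "unit1 B X"
  let ?GF = "hcomp1 B X Y X G F"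
  let ?UG = "hcomp1 B Y X X ?U G"
  let ?FU = "hcomp1 B X X Y F ?U"
  note U = B.unit1_in[OF X]
  note GF = B.hcomp1_in[OF X Y X F G]
  note UG = B.hcomp1_in[OF Y X X G U]
  note FU = B.hcomp1_in[OF X X Y U F]
  note lG = B.lunit_hom_iso[OF Y X G]
  note rF = B.runit_hom_iso[OF X Y F]
  note rGF = conjunct1[OF B.runit_hom_iso[OF X X GF]]
  note lGF = conjunct1[OF B.lunit_hom_iso[OF X X GF]]
  note aUGF = B.assoc_hom_iso[OF X Y X X F G U]
  note aGFU = B.assoc_hom_iso[OF X X Y X U F G]
  note aFUG = B.assoc_hom_iso[OF Y X X Y G U F]
  note iaUGF = XX.inverse_arrows_inv_arr[OF conjunct2[OF aUGF], folded assoc_inv_def]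
  note iaFUG = YY.inverse_arrows_inv_arr[OF conjunct2[OF aFUG], folded assoc_inv_def]
  note wFl = B.whisker_left_hom[OF Y X Y F conjunct1[OF lG]]
  note wlF = B.whisker_right_hom[OF X Y X F conjunct1[OF lG]]
  note wGr = B.whisker_left_hom[OF X Y X G conjunct1[OF rF]]
  note wrG = B.whisker_right_hom[OF Y X Y G conjunct1[OF rF]]
  define lF where "lF = sh_arr S (X, whisker_right B X Y X (lunit B Y X G) F)"
  define Fl where "Fl = sh_arr S (Y, whisker_left B Y X Y F (lunit B Y X G))"
  define Gr where "Gr = sh_arr S (X, whisker_left B X Y X G (runit B X Y F))"
  define rG where "rG = sh_arr S (Y, whisker_right B Y X Y (runit B X Y F) G)"
  define a1 where "a1 = sh_arr S (X, assoc B X Y X X ?U G F)"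
  define a1' where "a1' = sh_arr S (X, assoc_inv B X Y X X ?U G F)"
  define a2 where "a2 = sh_arr S (Y, assoc B Y X X Y F ?U G)"
  define a2' where "a2' = sh_arr S (Y, assoc_inv B Y X X Y F ?U G)"
  define a3 where "a3 = sh_arr S (X, assoc B X X Y X G F ?U)"
  define t0 where "t0 = theta S X X ?U ?GF"
  define t1 where "t1 = theta S Y X ?UG F"
  define t2 where "t2 = theta S X Y ?FU G"
  define T1 where "T1 = theta S Y X G F"
  define T2 where "T2 = theta S X Y F G"
  note lF = sh_arr_hom[OF X wlF, folded lF_def]
  note Fl = sh_arr_hom[OF Y wFl, folded Fl_def]
  note Gr = sh_arr_hom[OF X wGr, folded Gr_def]
  note rG = sh_arr_hom[OF Y wrG, folded rG_def]
  note a1 = sh_arr_hom[OF X conjunct1[OF aUGF], folded a1_def]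
  note a2 = sh_arr_hom[OF Y conjunct1[OF aFUG], folded a2_def]
  note a3 = sh_arr_hom[OF X conjunct1[OF aGFU], folded a3_def]
  note a1' = D.inverse_arrows_homD[OF sh_arr_inverse_arrows[OF X iaUGF, folded a1_def a1'_def] a1]
  note a2' = D.inverse_arrows_homD[OF sh_arr_inverse_arrows[OF Y iaFUG, folded a2_def a2'_def] a2]
  note t0 = theta_hom[OF X X U GF, folded t0_def]
  note t1 = theta_hom[OF Y X UG F, folded t1_def]
  note t2 = theta_hom[OF X Y FU G, folded t2_def]
  note T1 = theta_hom[OF Y X G F, folded T1_def]
  note T2 = theta_hom[OF X Y F G, folded T2_def]
  note homs = lF Fl Gr rG a1 a2 a3 conjunct1[OF a1'] conjunct1[OF a2'] t0 t1 t2 T1 T2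

  have hex: "a3 \<cdot> t0 = t2 \<cdot> a2' \<cdot> t1 \<cdot> a1'"
    using hexagon[OF X Y X F G U]
    by (simp add: a3_def t0_def t2_def a2'_def t1_def a1'_def)
  have kelly_l: "sh_arr S (X, lunit B X X ?GF) \<cdot> a1 = lF"
    using sh_arr_Comp[OF X conjunct1[OF aUGF] lGF] B.lunit_hcomp1[OF X Y X F G]
    by (simp add: a1_def lF_def)
  have kelly_r: "Gr \<cdot> a3 = sh_arr S (X, runit B X X ?GF)"
    using sh_arr_Comp[OF X conjunct1[OF aGFU] wGr] B.runit_hcomp1[OF X Y X F G]
    by (simp add: Gr_def a3_def)
  have "Fl \<cdot> a2 = rG"
    using sh_arr_Comp[OF Y conjunct1[OF aFUG] wFl] B.triangle[OF Y X Y G F]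
    by (simp add: Fl_def a2_def rG_def)
  then have mid: "rG \<cdot> a2' = Fl"
    using D.Comp_assoc[OF conjunct1[OF a2'] a2 Fl] a2' D.Ident_right[OF Fl] by simp
  have nat1: "Fl \<cdot> t1 = T1 \<cdot> lF"
    using theta_whisker_left[OF Y X conjunct1[OF lG] F] by (simp add: Fl_def t1_def T1_def lF_def)
  have nat2: "Gr \<cdot> t2 = T2 \<cdot> rG"
    using theta_whisker_left[OF X Y conjunct1[OF rF] G] by (simp add: Gr_def t2_def T2_def rG_def)

  have "lF = (sh_arr S (X, runit B X X ?GF) \<cdot> t0) \<cdot> a1"
    using theta_runit[OF X GF] kelly_l by (simp add: t0_def)
  also have "\<dots> = Gr \<cdot> ((a3 \<cdot> t0) \<cdot> a1)"
    using homs by (simp add: kelly_r[symmetric] D.Comp_assoc[OF t0 a3 Gr]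
        D.Comp_assoc[OF a1 D.Comp_hom[OF t0 a3] Gr])
  also have "(a3 \<cdot> t0) \<cdot> a1 = t2 \<cdot> a2' \<cdot> t1"
  proof -
    note c = D.Comp_hom[OF t1 D.Comp_hom[OF conjunct1[OF a2'] t2]]
    show ?thesis
      unfolding hex using D.Comp_assoc[OF a1 conjunct1[OF a1'] c] a1' D.Ident_right[OF c] by simp
  qed
  also have "Gr \<cdot> (t2 \<cdot> a2' \<cdot> t1) = (Gr \<cdot> t2) \<cdot> a2' \<cdot> t1"
    using D.Comp_assoc[OF t1 D.Comp_hom[OF conjunct1[OF a2'] t2] Gr]
      D.Comp_assoc[OF conjunct1[OF a2'] t2 Gr] by simp
  also have "\<dots> = (T2 \<cdot> Fl) \<cdot> t1"
    unfolding nat2 using D.Comp_assoc[OF conjunct1[OF a2'] rG T2] mid by simp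
  also have "\<dots> = (T2 \<cdot> T1) \<cdot> lF"
    using D.Comp_assoc[OF t1 Fl T2] D.Comp_assoc[OF lF T1 T2] nat1 by simp
  finally have *: "(T2 \<cdot> T1) \<cdot> lF = Ident D (sh_obj S (X, ?GF)) \<cdot> lF"
    using D.Ident_left[OF lF] by simp
  have "is_iso (HomCat B X X) (whisker_right B X Y X (lunit B Y X G) F)"
    by (rule B.whisker_right_is_iso[OF X Y X F conjunct2[OF lG]])
  then have iso: "is_iso D lF"
    unfolding lF_def is_iso_def using sh_arr_inverse_arrows[OF X] by blast
  have "Ident D (sh_obj S (X, ?GF)) \<in> hom D (sh_obj S (X, ?GF)) (sh_obj S (X, ?GF))"
    using lF D.Cod_in[of lF] by (intro D.Ident_hom) (simp add: hom_def)
  from D.is_iso_cancel_right[OF iso lF D.Comp_hom[OF T1 T2] this *]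
  show ?thesis by (simp add: T1_def T2_def)
qed

end


section \<open>Morita invariance\<close>

theorem proposition4p18:
  fixes B :: "('o, 'f, 't) bicat"
    and V :: "('d, 'e) cat"
    and S :: "('o, 'f, 't, 'd, 'e) shadow_data"
    and C D :: 'o and F G :: 'f and u c :: 't
  assumes "bicategory B"
    and "category V"
    and "shadow B V S"
    and "adjunction B C D F G u c"
    and "is_iso (HomCat B C C) u"
    and "is_iso (HomCat B D D) c"
  defines "chi_F \<equiv> euler_char B V S C D F G u c"
    and "chi_G \<equiv> euler_char B V S D C G F (inv_arr (HomCat B D D) c) (inv_arr (HomCat B C C) u)"
  shows "chi_F \<in> hom V (sh_obj S (C, unit1 B C)) (sh_obj S (D, unit1 B D))
       \<and> is_iso V chi_F
       \<and> inverse_arrows V chi_F chi_G"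
proof -
  interpret shadow B V S by fact
  interpret A: adjunction B C D F G u c by fact
  interpret CC: category "HomCat B C C" using B.HomCat_category[OF A.C_in A.C_in] .
  interpret DD: category "HomCat B D D" using B.HomCat_category[OF A.D_in A.D_in] .
  note su = sh_arr_hom[OF A.C_in A.u_hom] and sc = sh_arr_hom[OF A.D_in A.c_hom]
  note T1 = theta_hom[OF A.D_in A.C_in A.G_in A.F_in]
  note T2 = theta_hom[OF A.C_in A.D_in A.F_in A.G_in]
  note iu = sh_arr_inverse_arrows[OF A.C_in CC.inverse_arrows_inv_arr[OF assms(5)]]
  note ic = sh_arr_inverse_arrows[OF A.D_in DD.inverse_arrows_inv_arr[OF assms(6)]]
  note su' = conjunct1[OF D.inverse_arrows_homD[OF iu su]]
  note sc' = conjunct1[OF D.inverse_arrows_homD[OF ic sc]]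
  have i\<theta>: "inverse_arrows V (theta S D C G F) (theta S C D F G)"
    unfolding inverse_arrows_def
    using T1 T2 theta_theta[OF A.C_in A.D_in A.F_in A.G_in]
      theta_theta[OF A.D_in A.C_in A.G_in A.F_in] by blast
  have chi_F: "chi_F \<in> hom V (sh_obj S (C, unit1 B C)) (sh_obj S (D, unit1 B D))"
    unfolding chi_F_def euler_char_def using D.Comp_hom[OF su D.Comp_hom[OF T1 sc]] .
  have "chi_F = sh_arr S (D, c) \<cdot>\<^bsub>V\<^esub> (theta S D C G F \<cdot>\<^bsub>V\<^esub> sh_arr S (C, u))"
    unfolding chi_F_def euler_char_def using D.Comp_assoc[OF su T1 sc] .
  moreover have "inverse_arrows V \<dots> chi_G"
    unfolding chi_G_def euler_char_def
    using D.inverse_arrows_Comp[OF D.inverse_arrows_Comp[OF iu i\<theta> su T1] ic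
        D.Comp_hom[OF su T1] sc] .
  ultimately show ?thesis
    using chi_F unfolding is_iso_def by auto
qed

end
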